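(* Let $d\ge 2$ and let $I_1,I_2\subset\mathbb R^d$ be two non-degenerate line segments. For $j=1,2$ let $f_j\in L^1(I_j,\mathcal H^1)$ with $f_j>0$ $\mathcal H^1$-a.e. on $I_j$, and let $$\mu=f_1\,\mathcal H^1\!\restriction_{I_1}+f_2\,\mathcal H^1\!\restriction_{I_2}$$ be a Borel probability measure on $\mathbb R^d$. If $\mu$ is a spectral measure, then the following hold: (i) If $\mathcal H^1(I_1\cap I_2)=0$, then there exist constants $c_1,c_2>0$ such that $f_j=c_j$ $\mathcal H^1$-a.e. on $I_j$ for $j=1,2$; equivalently, $\mu=c_1\mathcal H^1\!\restriction_{I_1}+c_2\mathcal H^1\!\restriction_{I_2}$. (ii) If $\mathcal H^1(I_1\cap I_2)>0$, then $$f_1\mathbf 1_{I_1}+f_2\mathbf 1_{I_2}=\frac{1}{\mathcal H^1(I_1\cup I_2)}\quad \mathcal H^1\text{-a.e. on } I_1\cup I_2;$$ equivalently, $\mu=\frac{1}{\mathcal H^1(I_1\cup I_2)}\,\mathcal H^1\!\restriction_{I_1\cup I_2}$.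
   Context: $\mathcal H^1$ is one-dimensional Hausdorff measure (arc length on line segments), and $\mathcal H^1\!\restriction_{E}$ is its restriction to $E$. $\mathbf 1_{E}$ is the indicator function of $E$. In expressions involving both densities, each $f_j$ is extended by zero outside $I_j$. A Borel probability measure $\mu$ on $\mathbb R^d$ is called a spectral measure if there is a countable set $\Lambda\subset\mathbb R^d$ (called a spectrum of $\mu$) such that $\{e^{2\pi i\langle\lambda,x\rangle}\}_{\lambda\in\Lambda}$ is an orthonormal basis of $L^2(\mu)$. *)

theory Defs
  imports "HOL-Probability.Probability"
begin

text \<open>
  Covers are required to be bounded because the library function \<open>diameter\<close> is
  unspecified on unbounded sets. Finite covers are included, as \<open>U i\<close> may be empty and
  the diameter of the empty set is zero. There is no normalizing constant: in dimension one
  the sum of diameters already assigns to a line segment its length, see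
  \<open>emeasure_hausdorff1_closed_segment\<close>.
\<close>

definition hausdorff1_pre :: "real \<Rightarrow> 'a::metric_space set \<Rightarrow> ennreal" where
  "hausdorff1_pre \<delta> E =
     (INF U\<in>{U :: nat \<Rightarrow> 'a set. E \<subseteq> (\<Union>i. U i) \<and> (\<forall>i. bounded (U i) \<and> diameter (U i) \<le> \<delta>)}.
        \<Sum>i. ennreal (diameter (U i)))"

definition hausdorff1_outer :: "'a::metric_space set \<Rightarrow> ennreal" where
  "hausdorff1_outer E = (SUP \<delta>\<in>{0<..}. hausdorff1_pre \<delta> E)"

definition hausdorff1 :: "'a::metric_space measure" where
  "hausdorff1 = measure_of UNIV (sets borel) hausdorff1_outer"

lemma space_hausdorff1 [simp]: "space hausdorff1 = UNIV"
  by (simp add: hausdorff1_def space_measure_of_conv)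

lemma sets_hausdorff1 [simp, measurable_cong]: "sets hausdorff1 = sets borel"
  using sets.sigma_sets_eq[of borel] by (simp add: hausdorff1_def sets_measure_of_conv)

text \<open>
  \<open>measure_of\<close> yields the zero measure if it is applied to a set function that is not countably
  additive. The following lemmas show that this does not happen here: the outer measure
  is a metric outer measure, hence countably additive on the Borel sets.
\<close>

lemma hausdorff1_pre_mono: "A \<subseteq> B \<Longrightarrow> hausdorff1_pre \<delta> A \<le> hausdorff1_pre \<delta> B"
  unfolding hausdorff1_pre_def by (rule INF_superset_mono) auto

lemma hausdorff1_pre_antimono: "\<delta> \<le> \<delta>' \<Longrightarrow> hausdorff1_pre \<delta>' A \<le> hausdorff1_pre \<delta> A"
  unfolding hausdorff1_pre_def by (rule INF_superset_mono) (auto intro: order_trans)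

lemma hausdorff1_pre_le_outer: "\<delta> > 0 \<Longrightarrow> hausdorff1_pre \<delta> A \<le> hausdorff1_outer A"
  unfolding hausdorff1_outer_def by (rule SUP_upper) auto

lemma hausdorff1_outer_mono: "A \<subseteq> B \<Longrightarrow> hausdorff1_outer A \<le> hausdorff1_outer B"
  unfolding hausdorff1_outer_def by (rule SUP_mono) (auto intro: hausdorff1_pre_mono)

lemma hausdorff1_outer_empty [simp]: "hausdorff1_outer {} = 0"
proof -
  have "hausdorff1_pre \<delta> {} \<le> 0" if "\<delta> > 0" for \<delta>
    unfolding hausdorff1_pre_def using that
    by (intro INF_lower2[of "\<lambda>_. {}"]) auto
  then show ?thesis
    unfolding hausdorff1_outer_def by (intro antisym SUP_least) auto
qed

lemma hausdorff1_pre_subadditive: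
  fixes A :: "nat \<Rightarrow> 'a::metric_space set"
  shows "hausdorff1_pre \<delta> (\<Union>n. A n) \<le> (\<Sum>n. hausdorff1_pre \<delta> (A n))"
proof (rule ennreal_le_epsilon)
  fix e :: real
  assume e: "0 < e" and fin: "(\<Sum>n. hausdorff1_pre \<delta> (A n)) < top"
  have lt: "hausdorff1_pre \<delta> (A n) < hausdorff1_pre \<delta> (A n) + e * (1/2)^Suc n" for n
    using e fin by (auto simp add: less_top dest!: ennreal_suminf_lessD)
  have "\<exists>U. A n \<subseteq> (\<Union>i. U i) \<and> (\<forall>i. bounded (U i) \<and> diameter (U i) \<le> \<delta>) \<and>
      (\<Sum>i. ennreal (diameter (U i))) \<le> hausdorff1_pre \<delta> (A n) + e * (1/2)^Suc n" for n
    using lt[of n] unfolding hausdorff1_pre_def[of \<delta> "A n"] INF_less_iff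
    by (blast intro: less_imp_le)
  then obtain B where B: "\<And>n. A n \<subseteq> (\<Union>i. B n i)"
      "\<And>n i. bounded (B n i)" "\<And>n i. diameter (B n i) \<le> \<delta>"
      "\<And>n. (\<Sum>i. ennreal (diameter (B n i))) \<le> hausdorff1_pre \<delta> (A n) + e * (1/2)^Suc n"
    by metis
  define C where "C = case_prod B o prod_decode"
  have A_C: "(\<Union>n. A n) \<subseteq> (\<Union>i. C i)"
    using B(1) by (auto simp add: C_def subset_eq) (metis prod.case prod_encode_inverse)
  have "hausdorff1_pre \<delta> (\<Union>n. A n) \<le> (\<Sum>i. ennreal (diameter (C i)))"
    unfolding hausdorff1_pre_def using A_C B(2,3)
    by (intro INF_lower) (auto simp: C_def split_def)
  also have "\<dots> = (\<Sum>n. \<Sum>i. ennreal (diameter (B n i)))"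
    unfolding C_def comp_def
    using suminf_ennreal_2dimen[of "\<lambda>n. \<Sum>i. ennreal (diameter (B n i))"
        "\<lambda>p. ennreal (diameter (case_prod B p))"] by simp
  also have "\<dots> \<le> (\<Sum>n. hausdorff1_pre \<delta> (A n) + e * (1/2) ^ Suc n)"
    by (intro suminf_le allI B(4)) auto
  also have "\<dots> = (\<Sum>n. hausdorff1_pre \<delta> (A n)) + (\<Sum>n. ennreal e * ennreal ((1/2) ^ Suc n))"
    using e by (subst suminf_add[symmetric])
      (auto simp del: ennreal_suminf_cmult simp add: ennreal_mult[symmetric])
  also have "\<dots> = (\<Sum>n. hausdorff1_pre \<delta> (A n)) + e"
    unfolding ennreal_suminf_cmult
    by (subst suminf_ennreal_eq[OF zero_le_power power_half_series]) auto
  finally show "hausdorff1_pre \<delta> (\<Union>n. A n) \<le> (\<Sum>n. hausdorff1_pre \<delta> (A n)) + e" .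
qed

lemma hausdorff1_outer_countably_subadditive:
  fixes A :: "nat \<Rightarrow> 'a::metric_space set"
  shows "hausdorff1_outer (\<Union>n. A n) \<le> (\<Sum>n. hausdorff1_outer (A n))"
  unfolding hausdorff1_outer_def[of "\<Union>n. A n"]
proof (rule SUP_least)
  fix \<delta> :: real assume "\<delta> \<in> {0<..}"
  then have "(\<Sum>n. hausdorff1_pre \<delta> (A n)) \<le> (\<Sum>n. hausdorff1_outer (A n))"
    by (intro suminf_le allI hausdorff1_pre_le_outer) auto
  then show "hausdorff1_pre \<delta> (\<Union>n. A n) \<le> (\<Sum>n. hausdorff1_outer (A n))"
    using hausdorff1_pre_subadditive[of \<delta> A] by (rule order_trans[rotated])
qed

lemma outer_measure_space_hausdorff1_outer:
  "outer_measure_space (Pow UNIV) (hausdorff1_outer :: 'a::metric_space set \<Rightarrow> ennreal)"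
  using hausdorff1_outer_countably_subadditive
  by (auto simp: outer_measure_space_def positive_def increasing_def
      countably_subadditive_def hausdorff1_outer_mono)

lemma hausdorff1_outer_Un_le:
  "hausdorff1_outer (A \<union> B) \<le> hausdorff1_outer A + hausdorff1_outer B"
proof -
  have "hausdorff1_outer (\<Union>n. binaryset A B n) \<le> (\<Sum>n. hausdorff1_outer (binaryset A B n))"
    by (rule hausdorff1_outer_countably_subadditive)
  then show ?thesis
    using suminf_binaryset_eq[of hausdorff1_outer A B] by (simp add: UN_binaryset_eq)
qed

lemma hausdorff1_outer_separated:
  fixes A B :: "'a::metric_space set"
  assumes \<eta>: "\<eta> > 0" and sep: "\<And>x y. x \<in> A \<Longrightarrow> y \<in> B \<Longrightarrow> dist x y \<ge> \<eta>"
  shows "hausdorff1_outer A + hausdorff1_outer B \<le> hausdorff1_outer (A \<union> B)"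
proof -
  have small: "hausdorff1_pre \<delta> A + hausdorff1_pre \<delta> B \<le> hausdorff1_pre \<delta> (A \<union> B)"
    if \<delta>: "0 < \<delta>" "\<delta> < \<eta>" for \<delta>
    unfolding hausdorff1_pre_def[of \<delta> "A \<union> B"]
  proof (rule INF_greatest)
    fix U :: "nat \<Rightarrow> 'a set"
    assume "U \<in> {U. A \<union> B \<subseteq> (\<Union>i. U i) \<and> (\<forall>i. bounded (U i) \<and> diameter (U i) \<le> \<delta>)}"
    then have U: "A \<union> B \<subseteq> (\<Union>i. U i)" "\<And>i. bounded (U i)" "\<And>i. diameter (U i) \<le> \<delta>"
      by auto
    have disj: "U i \<inter> A = {} \<or> U i \<inter> B = {}" for i
    proof (rule ccontr)
      assume "\<not> ?thesis"
      then obtain x y where xy: "x \<in> U i" "x \<in> A" "y \<in> U i" "y \<in> B" by auto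
      then have "dist x y \<le> diameter (U i)"
        using U(2) diameter_bounded_bound by blast
      then show False using sep[OF xy(2,4)] U(3)[of i] \<delta> by linarith
    qed
    define V where "V i = (if U i \<inter> A = {} then {} else U i)" for i
    define W where "W i = (if U i \<inter> B = {} then {} else U i)" for i
    have V: "A \<subseteq> (\<Union>i. V i)" "B \<subseteq> (\<Union>i. W i)"
      using U(1) by (fastforce simp: V_def W_def)+
    have "hausdorff1_pre \<delta> A \<le> (\<Sum>i. ennreal (diameter (V i)))"
      unfolding hausdorff1_pre_def using U(2,3) \<delta> V by (intro INF_lower) (auto simp: V_def)
    moreover have "hausdorff1_pre \<delta> B \<le> (\<Sum>i. ennreal (diameter (W i)))"
      unfolding hausdorff1_pre_def using U(2,3) \<delta> V by (intro INF_lower) (auto simp: W_def)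
    ultimately have "hausdorff1_pre \<delta> A + hausdorff1_pre \<delta> B \<le>
        (\<Sum>i. ennreal (diameter (V i))) + (\<Sum>i. ennreal (diameter (W i)))"
      by (rule add_mono)
    also have "\<dots> = (\<Sum>i. ennreal (diameter (V i)) + ennreal (diameter (W i)))"
      by (rule suminf_add) auto
    also have "\<dots> \<le> (\<Sum>i. ennreal (diameter (U i)))"
      using disj by (intro suminf_le allI) (auto simp: V_def W_def)
    finally show "hausdorff1_pre \<delta> A + hausdorff1_pre \<delta> B \<le> (\<Sum>i. ennreal (diameter (U i)))" .
  qed
  have "hausdorff1_pre \<delta> A + hausdorff1_pre \<delta>' B \<le> hausdorff1_outer (A \<union> B)"
    if "\<delta> > 0" "\<delta>' > 0" for \<delta> \<delta>'
  proof -
    define r where "r = min (min \<delta> \<delta>') (\<eta> / 2)"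
    have r: "0 < r" "r < \<eta>" "r \<le> \<delta>" "r \<le> \<delta>'" using that \<eta> by (auto simp: r_def)
    have "hausdorff1_pre \<delta> A + hausdorff1_pre \<delta>' B \<le> hausdorff1_pre r A + hausdorff1_pre r B"
      using r by (intro add_mono hausdorff1_pre_antimono)
    also have "\<dots> \<le> hausdorff1_outer (A \<union> B)"
      using small[OF r(1,2)] hausdorff1_pre_le_outer[OF r(1)] by (rule order_trans)
    finally show ?thesis .
  qed
  then have "hausdorff1_pre \<delta> A + hausdorff1_outer B \<le> hausdorff1_outer (A \<union> B)" if "\<delta> > 0" for \<delta>
    unfolding hausdorff1_outer_def[of B] using that
    by (subst ennreal_SUP_add_right) (auto intro!: SUP_least)
  then show ?thesis
    unfolding hausdorff1_outer_def[of A]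
    by (subst ennreal_SUP_add_left[symmetric]) (auto intro!: SUP_least)
qed

lemma hausdorff1_outer_closed:
  fixes A C :: "'a::metric_space set"
  assumes C: "closed C"
  shows "hausdorff1_outer (A \<inter> C) + hausdorff1_outer (A - C) \<le> hausdorff1_outer A"
proof (cases "C = {} \<or> hausdorff1_outer A = top")
  case False
  then have ne: "C \<noteq> {}" and fin: "hausdorff1_outer A < top" by (auto simp: less_top)
  let ?H = "hausdorff1_outer :: 'a set \<Rightarrow> ennreal"
  define D where "D n = {x\<in>A. infdist x C \<ge> 1 / (real n + 1)}" for n
  define R where "R n = D (Suc n) - D n" for n
  have infd: "infdist x C - infdist y C \<le> dist x y" for x y
    using infdist_triangle[of x C y] by simp
  have D_mono: "D m \<subseteq> D n" if "m \<le> n" for m n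
  proof -
    have "1 / (real n + 1) \<le> 1 / (real m + 1)" using that by (intro frac_le) auto
    then show ?thesis by (auto simp: D_def)
  qed
  have sep: "?H X + ?H Y \<le> ?H (X \<union> Y)" if X: "X \<subseteq> D n" and Y: "Y \<subseteq> A - D (Suc n)" for X Y n
  proof (rule hausdorff1_outer_separated)
    have "1 / (real (Suc n) + 1) < 1 / (real n + 1)" by (rule divide_strict_left_mono) auto
    then show "0 < 1 / (real n + 1) - 1 / (real (Suc n) + 1)" by simp
    fix x y assume "x \<in> X" "y \<in> Y"
    with X Y have "infdist x C \<ge> 1 / (real n + 1)" "infdist y C < 1 / (real (Suc n) + 1)"
      by (auto simp: D_def)
    then show "1 / (real n + 1) - 1 / (real (Suc n) + 1) \<le> dist x y"
      using infd[of x y] by linarith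
  qed
  have part: "(\<Sum>k<n. ?H (R (2 * k + p))) \<le> ?H A" for n p
  proof -
    have "(\<Sum>k<n. ?H (R (2 * k + p))) \<le> ?H (\<Union>k<n. R (2 * k + p))"
    proof (induction n)
      case (Suc n)
      have "?H (\<Union>k<n. R (2 * k + p)) + ?H (R (2 * n + p))
          \<le> ?H ((\<Union>k<n. R (2 * k + p)) \<union> R (2 * n + p))"
      proof (cases n)
        case (Suc m)
        have "R (2 * k + p) \<subseteq> D (2 * m + p + 1)" if "k < n" for k
          using that Suc D_mono[of "Suc (2 * k + p)" "2 * m + p + 1"] by (auto simp: R_def)
        moreover have "R (2 * n + p) \<subseteq> A - D (Suc (2 * m + p + 1))"
          using Suc by (auto simp: R_def D_def)
        ultimately show ?thesis by (intro sep) auto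
      qed simp
      moreover have "(\<Union>k<n. R (2 * k + p)) \<union> R (2 * n + p) = (\<Union>k<Suc n. R (2 * k + p))"
        by (auto simp: lessThan_Suc)
      ultimately show ?case
        using Suc.IH by (auto intro: order_trans add_right_mono)
    qed simp
    also have "\<dots> \<le> ?H A"
      by (rule hausdorff1_outer_mono) (auto simp: R_def D_def)
    finally show ?thesis .
  qed
  have split: "(\<Sum>k<2 * n. ?H (R k)) = (\<Sum>k<n. ?H (R (2 * k + 0))) + (\<Sum>k<n. ?H (R (2 * k + 1)))"
    for n by (induction n) (auto simp: algebra_simps)
  define S where "S = (\<Sum>k. ?H (R k))"
  have "S \<le> ?H A + ?H A"
    unfolding S_def suminf_eq_SUP
  proof (rule SUP_least)
    fix n
    have "(\<Sum>k<n. ?H (R k)) \<le> (\<Sum>k<2 * n. ?H (R k))"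
      by (rule sum_mono2) auto
    also have "\<dots> \<le> ?H A + ?H A"
      unfolding split by (intro add_mono part)
    finally show "(\<Sum>k<n. ?H (R k)) \<le> ?H A + ?H A" .
  qed
  moreover have "?H A + ?H A < top" using fin by (simp add: less_top)
  ultimately have S: "S < top" by (rule le_less_trans)
  have cover: "A - C \<subseteq> D n \<union> (\<Union>k. R (k + n))" for n
  proof
    fix x assume x: "x \<in> A - C"
    then have "infdist x C > 0"
      using C ne by (metis DiffD2 infdist_nonneg in_closed_iff_infdist_zero less_le)
    then obtain m where "inverse (real (Suc m)) < infdist x C"
      using reals_Archimedean by blast
    then have ex: "x \<in> D m" using x by (auto simp: D_def inverse_eq_divide add.commute)
    define l where "l = (LEAST m. x \<in> D m)"
    have l: "x \<in> D l" "\<And>j. j < l \<Longrightarrow> x \<notin> D j"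
      unfolding l_def using ex by (auto intro: LeastI dest: not_less_Least)
    show "x \<in> D n \<union> (\<Union>k. R (k + n))"
    proof (cases "l \<le> n")
      case True
      then show ?thesis using l D_mono by blast
    next
      case False
      then obtain k where "l = Suc (k + n)"
        by (metis add.commute add_Suc_right less_imp_Suc_add not_le)
      then have "x \<in> R (k + n)" using l by (auto simp: R_def)
      then show ?thesis by auto
    qed
  qed
  have bound: "?H (A \<inter> C) + ?H (A - C) + (\<Sum>k<n. ?H (R k)) \<le> ?H A + S" for n
  proof -
    have "?H (A - C) \<le> ?H (D n) + ?H (\<Union>k. R (k + n))"
      using hausdorff1_outer_mono[OF cover] hausdorff1_outer_Un_le by (rule order_trans)
    also have "\<dots> \<le> ?H (D n) + (\<Sum>k. ?H (R (k + n)))"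
      by (intro add_left_mono hausdorff1_outer_countably_subadditive)
    finally have 1: "?H (A - C) \<le> ?H (D n) + (\<Sum>k. ?H (R (k + n)))" .
    have "A \<inter> C \<subseteq> A - D (Suc n)" by (auto simp: D_def)
    then have "?H (D n) + ?H (A \<inter> C) \<le> ?H (D n \<union> (A \<inter> C))" by (intro sep) auto
    also have "\<dots> \<le> ?H A" by (rule hausdorff1_outer_mono) (auto simp: D_def)
    finally have 2: "?H (D n) + ?H (A \<inter> C) \<le> ?H A" .
    have 3: "S = (\<Sum>k. ?H (R (k + n))) + (\<Sum>k<n. ?H (R k))"
      unfolding S_def by (rule suminf_offset) auto
    have "?H (A \<inter> C) + ?H (A - C) + (\<Sum>k<n. ?H (R k))
        \<le> ?H (A \<inter> C) + (?H (D n) + (\<Sum>k. ?H (R (k + n)))) + (\<Sum>k<n. ?H (R k))"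
      using 1 by (intro add_mono order_refl)
    also have "\<dots> = (?H (D n) + ?H (A \<inter> C)) + S"
      unfolding 3 by (simp add: ac_simps)
    also have "\<dots> \<le> ?H A + S" using 2 by (rule add_right_mono)
    finally show ?thesis .
  qed
  have "(\<lambda>n. \<Sum>k<n. ?H (R k)) \<longlonglongrightarrow> S"
    unfolding S_def by (rule summable_LIMSEQ) auto
  then have "(\<lambda>n. ?H (A \<inter> C) + ?H (A - C) + (\<Sum>k<n. ?H (R k)))
      \<longlonglongrightarrow> ?H (A \<inter> C) + ?H (A - C) + S"
    by (intro tendsto_add tendsto_const)
  then have "?H (A \<inter> C) + ?H (A - C) + S \<le> ?H A + S"
    using bound by (intro LIMSEQ_le_const2) auto
  then have "S + (?H (A \<inter> C) + ?H (A - C)) \<le> S + ?H A" by (simp add: ac_simps)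
  then show ?thesis using S by (auto simp: ennreal_add_left_cancel_le)
qed auto

lemma measure_space_hausdorff1_outer:
  "measure_space UNIV (sets borel) (hausdorff1_outer :: 'a::metric_space set \<Rightarrow> ennreal)"
proof -
  let ?L = "lambda_system UNIV (Pow UNIV) (hausdorff1_outer :: 'a set \<Rightarrow> ennreal)"
  have ms: "measure_space UNIV ?L hausdorff1_outer"
    by (rule sigma_algebra.caratheodory_lemma
        [OF sigma_algebra_Pow outer_measure_space_hausdorff1_outer])
  then interpret L: sigma_algebra UNIV ?L by (simp add: measure_space_def)
  have closed_L: "C \<in> ?L" if "closed C" for C :: "'a set"
  proof -
    have "hausdorff1_outer (A \<inter> C) + hausdorff1_outer (A - C) = hausdorff1_outer A" for A
    proof (rule antisym[OF hausdorff1_outer_closed[OF that]])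
      have "A = (A \<inter> C) \<union> (A - C)" by auto
      then show "hausdorff1_outer A \<le> hausdorff1_outer (A \<inter> C) + hausdorff1_outer (A - C)"
        using hausdorff1_outer_Un_le[of "A \<inter> C" "A - C"] by simp
    qed
    then show ?thesis
      using algebra.lambda_system_eq[OF algebra_Pow, of UNIV hausdorff1_outer] by auto
  qed
  have "sets (borel :: 'a measure) \<subseteq> ?L"
    unfolding borel_eq_closed using closed_L L.sigma_sets_subset[of "Collect closed"]
    by (auto simp: sets_measure_of_conv)
  then show ?thesis
    using measure_down[OF ms] sets.sigma_algebra_axioms[of "borel :: 'a measure"] by simp
qed

lemma emeasure_hausdorff1:
  assumes "A \<in> sets borel"
  shows "emeasure hausdorff1 A = hausdorff1_outer A"
  unfolding hausdorff1_def
  using measure_space_hausdorff1_outer assms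
  by (intro emeasure_measure_of_sigma) (auto simp: measure_space_def)

lemma diameter_closed_segment:
  fixes a b :: "'a::real_normed_vector"
  shows "diameter (closed_segment a b) = dist a b"
proof (rule antisym)
  show "diameter (closed_segment a b) \<le> dist a b"
  proof (rule diameter_le)
    fix x y assume "x \<in> closed_segment a b" "y \<in> closed_segment a b"
    then obtain s t where s: "0 \<le> s" "s \<le> 1" "x = (1 - s) *\<^sub>R a + s *\<^sub>R b"
      and t: "0 \<le> t" "t \<le> 1" "y = (1 - t) *\<^sub>R a + t *\<^sub>R b"
      by (auto simp: in_segment)
    have "x - y = (t - s) *\<^sub>R (a - b)" unfolding s(3) t(3) by (simp add: algebra_simps)
    then have "norm (x - y) = \<bar>t - s\<bar> * dist a b" by (simp add: dist_norm)
    also have "\<dots> \<le> dist a b" using s t by (intro mult_left_le_one_le) auto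
    finally show "norm (x - y) \<le> dist a b" .
  qed simp
  show "dist a b \<le> diameter (closed_segment a b)"
    by (intro diameter_bounded_bound bounded_closed_segment) auto
qed

lemma emeasure_hausdorff1_closed_segment:
  fixes a b :: "'a::euclidean_space"
  shows "emeasure hausdorff1 (closed_segment a b) = ennreal (dist a b)"
proof (rule antisym)
  have H: "emeasure hausdorff1 (closed_segment a b) = hausdorff1_outer (closed_segment a b)"
    by (intro emeasure_hausdorff1) (simp add: borel_closed)
  show "emeasure hausdorff1 (closed_segment a b) \<le> ennreal (dist a b)"
    unfolding H hausdorff1_outer_def
  proof (rule SUP_least)
    fix \<delta> :: real assume "\<delta> \<in> {0<..}"
    then have \<delta>: "\<delta> > 0" by simp
    obtain m where "dist a b / \<delta> < real m" using reals_Archimedean2 by blast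
    moreover define n where "n = Suc m"
    ultimately have n: "n > 0" "dist a b / \<delta> \<le> real n" by auto
    then have small: "dist a b / n \<le> \<delta>" using \<delta> by (simp add: field_simps)
    define p where "p t = a + t *\<^sub>R (b - a)" for t :: real
    define U where "U i = (if i < n then closed_segment (p (i / n)) (p (Suc i / n)) else {})" for i
    have "p (Suc i / n) - p (i / n) = (1 / n) *\<^sub>R (b - a)" for i
      by (simp add: p_def scaleR_left_diff_distrib[symmetric] diff_divide_distrib[symmetric])
    then have dp: "dist (p (i / n)) (p (Suc i / n)) = dist a b / n" for i
      by (subst dist_commute) (simp only: dist_norm norm_scaleR, simp add: norm_minus_commute)
    have diam: "diameter (U i) = (if i < n then dist a b / n else 0)" for i
      by (simp only: U_def diameter_closed_segment dp diameter_empty if_distrib[of diameter])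
    have "closed_segment a b \<subseteq> (\<Union>i. U i)"
    proof
      fix x assume "x \<in> closed_segment a b"
      then obtain t where t: "0 \<le> t" "t \<le> 1" "x = p t"
        by (auto simp: in_segment p_def algebra_simps)
      define i where "i = (if t = 1 then n - 1 else nat \<lfloor>t * n\<rfloor>)"
      have i: "i < n" "i \<le> t * n" "t * n \<le> Suc i"
      proof -
        show "i < n" using t n by (auto simp: i_def nat_less_iff floor_less_iff)
        show "i \<le> t * n" using t n by (auto simp: i_def of_nat_diff)
        show "t * n \<le> Suc i" using t n by (auto simp: i_def of_nat_diff) linarith
      qed
      define s where "s = t * n - i"
      have s: "0 \<le> s" "s \<le> 1" using i by (auto simp: s_def)
      have "t = (1 - s) * (i / n) + s * (Suc i / n)"
        using n by (simp add: s_def field_simps)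
      then have "x = (1 - s) *\<^sub>R p (i / n) + s *\<^sub>R p (Suc i / n)"
        unfolding t(3) p_def by (simp add: algebra_simps)
      then have "x \<in> U i" using i s by (auto simp: U_def in_segment)
      then show "x \<in> (\<Union>i. U i)" by blast
    qed
    then have "hausdorff1_pre \<delta> (closed_segment a b) \<le> (\<Sum>i. ennreal (diameter (U i)))"
      unfolding hausdorff1_pre_def using small \<delta>
      by (intro INF_lower) (auto simp: diam, auto simp: U_def bounded_closed_segment)
    also have "\<dots> = (\<Sum>i<n. ennreal (dist a b / n))"
      by (subst suminf_finite[of "{..<n}"]) (auto simp: diam)
    also have "\<dots> = ennreal (dist a b)"
      using n by (subst sum_ennreal) (auto)
    finally show "hausdorff1_pre \<delta> (closed_segment a b) \<le> ennreal (dist a b)" .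
  qed
  have "ennreal (dist a b) \<le> hausdorff1_pre 1 (closed_segment a b)"
    unfolding hausdorff1_pre_def
  proof (rule INF_greatest)
    fix U :: "nat \<Rightarrow> 'a set"
    assume "U \<in> {U. closed_segment a b \<subseteq> (\<Union>i. U i) \<and> (\<forall>i. bounded (U i) \<and> diameter (U i) \<le> 1)}"
    then have U: "closed_segment a b \<subseteq> (\<Union>i. U i)" "\<And>i. bounded (U i)" by auto
    define u where "u = sgn (b - a)"
    have u: "norm u \<le> 1" by (simp add: u_def norm_sgn)
    have bu: "(b - a) \<bullet> u = dist a b"
      by (simp add: u_def sgn_div_norm dist_norm norm_minus_commute power2_norm_eq_inner[symmetric]
          power2_eq_square) (auto intro: left_inverse)
    have "\<exists>c. \<forall>x\<in>U i. c \<le> x \<bullet> u \<and> x \<bullet> u \<le> c + diameter (U i)" for i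
    proof (cases "U i = {}")
      case False
      have diff: "x \<bullet> u - y \<bullet> u \<le> diameter (U i)" if "x \<in> U i" "y \<in> U i" for x y
      proof -
        have "x \<bullet> u - y \<bullet> u \<le> norm (x - y) * norm u"
          using norm_cauchy_schwarz[of "x - y" u] by (simp add: inner_diff_left)
        also have "\<dots> \<le> dist x y"
          using u by (simp add: dist_norm mult_left_le)
        also have "\<dots> \<le> diameter (U i)"
          using U(2) that by (intro diameter_bounded_bound)
        finally show ?thesis .
      qed
      obtain z where z: "z \<in> U i" using False by auto
      have bdd: "bdd_below ((\<lambda>x. x \<bullet> u) ` U i)"
        using diff[OF z] by (intro bdd_belowI2[of _ "z \<bullet> u - diameter (U i)"]) (simp add: algebra_simps)
      show ?thesis
      proof (intro exI[of _ "INF x\<in>U i. x \<bullet> u"] ballI conjI)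
        fix x assume x: "x \<in> U i"
        show "(INF x\<in>U i. x \<bullet> u) \<le> x \<bullet> u" using bdd x by (rule cINF_lower)
        have "x \<bullet> u - diameter (U i) \<le> (INF x\<in>U i. x \<bullet> u)"
        proof (rule cINF_greatest[OF False])
          fix y assume "y \<in> U i"
          then show "x \<bullet> u - diameter (U i) \<le> y \<bullet> u" using diff[OF x] by (simp add: algebra_simps)
        qed
        then show "x \<bullet> u \<le> (INF x\<in>U i. x \<bullet> u) + diameter (U i)" by simp
      qed
    qed auto
    then obtain c where c: "\<And>i x. x \<in> U i \<Longrightarrow> c i \<le> x \<bullet> u \<and> x \<bullet> u \<le> c i + diameter (U i)"
      by metis
    have sub: "{a \<bullet> u..b \<bullet> u} \<subseteq> (\<Union>i. {c i..c i + diameter (U i)})"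
    proof
      fix r assume r: "r \<in> {a \<bullet> u..b \<bullet> u}"
      obtain x where x: "x \<in> closed_segment a b" "x \<bullet> u = r"
      proof (cases "a = b")
        case True
        then show ?thesis using r that[of a] by auto
      next
        case False
        define t where "t = (r - a \<bullet> u) / dist a b"
        have "0 \<le> t" "t \<le> 1" using r bu False by (auto simp: t_def inner_diff_left field_simps)
        moreover have "((1 - t) *\<^sub>R a + t *\<^sub>R b) \<bullet> u = a \<bullet> u + t * ((b - a) \<bullet> u)"
          by (simp add: inner_add_left inner_diff_left algebra_simps)
        ultimately show ?thesis
          using False by (intro that[of "(1 - t) *\<^sub>R a + t *\<^sub>R b"]) (auto simp: in_segment bu t_def)
      qed
      then show "r \<in> (\<Union>i. {c i..c i + diameter (U i)})" using U(1) c by fastforce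
    qed
    have "ennreal (dist a b) = emeasure lborel {a \<bullet> u..b \<bullet> u}"
      using bu by (subst emeasure_lborel_Icc) (auto simp: inner_diff_left, smt (verit) zero_le_dist)
    also have "\<dots> \<le> emeasure lborel (\<Union>i. {c i..c i + diameter (U i)})"
      using sub by (intro emeasure_mono) auto
    also have "\<dots> \<le> (\<Sum>i. emeasure lborel {c i..c i + diameter (U i)})"
      by (intro emeasure_subadditive_countably) auto
    also have "\<dots> = (\<Sum>i. ennreal (diameter (U i)))"
      using U(2) by (simp add: diameter_ge_0)
    finally show "ennreal (dist a b) \<le> (\<Sum>i. ennreal (diameter (U i)))" .
  qed
  also have "\<dots> \<le> hausdorff1_outer (closed_segment a b)"
    by (rule hausdorff1_pre_le_outer) simp
  finally show "ennreal (dist a b) \<le> emeasure hausdorff1 (closed_segment a b)"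
    unfolding H .
qed


text \<open>
  The restriction keeps the ambient space and \<open>\<sigma>\<close>-algebra, unlike \<open>restrict_space\<close>:
  it maps a Borel set \<open>A\<close> to the measure of \<open>A \<inter> E\<close>.
\<close>

definition restr :: "'a measure \<Rightarrow> 'a set \<Rightarrow> 'a measure" where
  "restr M E = density M (indicator E)"

lemma sets_restr [simp, measurable_cong]: "sets (restr M E) = sets M"
  by (simp add: restr_def)

lemma space_restr [simp]: "space (restr M E) = space M"
  by (simp add: restr_def)

lemma emeasure_restr:
  assumes "E \<in> sets M" "A \<in> sets M"
  shows "emeasure (restr M E) A = emeasure M (A \<inter> E)"
  using assms by (simp add: restr_def emeasure_density indicator_inter_arith[symmetric]
      Int_commute sets.Int)

definition add_measure :: "'a measure \<Rightarrow> 'a measure \<Rightarrow> 'a measure" where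
  "add_measure M N = measure_of (space M) (sets M) (\<lambda>A. emeasure M A + emeasure N A)"

lemma sets_add_measure [simp, measurable_cong]: "sets (add_measure M N) = sets M"
  by (simp add: add_measure_def)

lemma space_add_measure [simp]: "space (add_measure M N) = space M"
  by (simp add: add_measure_def)

lemma emeasure_add_measure:
  assumes "sets M = sets N" "A \<in> sets M"
  shows "emeasure (add_measure M N) A = emeasure M A + emeasure N A"
  unfolding add_measure_def
proof (rule emeasure_measure_of_sigma[OF sets.sigma_algebra_axioms _ _ assms(2)])
  show "positive (sets M) (\<lambda>A. emeasure M A + emeasure N A)"
    by (simp add: positive_def)
  show "countably_additive (sets M) (\<lambda>A. emeasure M A + emeasure N A)"
  proof (rule countably_additiveI)
    fix F :: "nat \<Rightarrow> 'a set" assume F: "range F \<subseteq> sets M" "disjoint_family F"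
    then show "(\<Sum>i. emeasure M (F i) + emeasure N (F i)) = emeasure M (\<Union>i. F i) + emeasure N (\<Union>i. F i)"
      using assms(1) by (simp add: suminf_add[symmetric] suminf_emeasure)
  qed
qed


definition L2_fun :: "'a measure \<Rightarrow> ('a \<Rightarrow> complex) \<Rightarrow> bool" where
  "L2_fun M f \<longleftrightarrow> f \<in> borel_measurable M \<and> integrable M (\<lambda>x. (cmod (f x))\<^sup>2)"

definition L2_inner :: "'a measure \<Rightarrow> ('a \<Rightarrow> complex) \<Rightarrow> ('a \<Rightarrow> complex) \<Rightarrow> complex" where
  "L2_inner M f g = (LINT x|M. f x * cnj (g x))"

text \<open>
  \<open>L\<^sup>2(M)\<close> is represented by measurable functions rather than by equivalence classes. The last
  conjunct is completeness: the linear span of the family is dense in \<open>L\<^sup>2(M)\<close>.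
\<close>

definition L2_orthonormal_basis :: "'a measure \<Rightarrow> 'i set \<Rightarrow> ('i \<Rightarrow> 'a \<Rightarrow> complex) \<Rightarrow> bool" where
  "L2_orthonormal_basis M I e \<longleftrightarrow>
     (\<forall>i\<in>I. L2_fun M (e i)) \<and>
     (\<forall>i\<in>I. \<forall>j\<in>I. L2_inner M (e i) (e j) = (if i = j then 1 else 0)) \<and>
     (\<forall>f. L2_fun M f \<longrightarrow> (\<forall>\<epsilon>>0. \<exists>F c. finite F \<and> F \<subseteq> I \<and>
        (LINT x|M. (cmod (f x - (\<Sum>i\<in>F. c i * e i x)))\<^sup>2) < \<epsilon>))"

definition exp_char :: "'a::real_inner \<Rightarrow> 'a \<Rightarrow> complex" where
  "exp_char l x = exp (2 * of_real pi * \<i> * of_real (l \<bullet> x))"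

definition spectrum_of :: "'a::euclidean_space measure \<Rightarrow> 'a set \<Rightarrow> bool" where
  "spectrum_of M L \<longleftrightarrow> countable L \<and> L2_orthonormal_basis M L exp_char"

definition spectral_measure :: "'a::euclidean_space measure \<Rightarrow> bool" where
  "spectral_measure M \<longleftrightarrow> prob_space M \<and> sets M = sets borel \<and> (\<exists>L. spectrum_of M L)"

end

theory Submission
  imports Defs
begin

text \<open>
  Parseval's identity shows that two functions in \<open>L\<^sup>2(\<mu>)\<close> whose coefficients with respect to the
  spectrum agree in modulus have the same norm. Write \<open>\<mu> = g \<H>\<^sup>1\<close>, let \<open>g > 0\<close> on \<open>S\<close> and, for a
  translation \<open>v\<close>, let \<open>A\<close> be the set of all \<open>x \<in> S\<close> with \<open>x + v \<in> S\<close> and \<open>g x < g (x + v)\<close>.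
  The measure \<open>\<one>\<^sub>A \<mu>\<close> and its translate by \<open>v\<close>, which is \<open>f' \<mu>\<close> for
  \<open>f' x = \<one>\<^sub>A (x - v) g (x - v) / g x\<close>, have Fourier transforms of equal modulus. Hence
  \<open>\<integral>\<^sub>A g = \<integral>\<^sub>A g\<^sup>2 / g(\<cdot> + v)\<close>, which forces \<open>A\<close> to be null since \<open>g < g(\<cdot> + v)\<close> on \<open>A\<close>.
  So \<open>g\<close> is almost everywhere invariant under each translation as long as it stays in \<open>S\<close>, and
  by Fubini it is constant on \<open>S\<close> if \<open>S\<close> lies in a segment. This is applied to each segment in (i)
  and to the union of the segments, which then are collinear, in (ii).
\<close>

section \<open>Parseval's identity for orthonormal bases of square-integrable functions\<close>

lemma borel_measurable_cnj [measurable (raw)]: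
  "f \<in> borel_measurable M \<Longrightarrow> (\<lambda>x. cnj (f x)) \<in> borel_measurable M"
  by (simp add: borel_measurable_complex_iff)

lemma L2_fun_integrable_mult:
  assumes "L2_fun M f" "L2_fun M g"
  shows "integrable M (\<lambda>x. f x * cnj (g x))"
proof (rule Bochner_Integration.integrable_bound)
  show "integrable M (\<lambda>x. (cmod (f x))\<^sup>2 + (cmod (g x))\<^sup>2)"
    using assms by (auto simp: L2_fun_def)
  have [measurable]: "f \<in> borel_measurable M" "g \<in> borel_measurable M"
    using assms by (auto simp: L2_fun_def)
  show "(\<lambda>x. f x * cnj (g x)) \<in> borel_measurable M"
    by measurable
  have "a * b \<le> a\<^sup>2 + b\<^sup>2" for a b :: real
    using sum_squares_bound[of a b] sum_power2_ge_zero[of a b] by linarith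
  then show "AE x in M. norm (f x * cnj (g x)) \<le> norm ((cmod (f x))\<^sup>2 + (cmod (g x))\<^sup>2)"
    by (auto simp: norm_mult)
qed

text \<open>Writing the squared modulus as a number times its conjugate, the two cross terms are
  conjugate to each other and add up to twice a real part.\<close>

lemma cmod_diff_scaled_power2:
  "(cmod (u - c * w))\<^sup>2 = (cmod u)\<^sup>2 - 2 * Re (cnj c * (u * cnj w)) + (cmod c)\<^sup>2 * (cmod w)\<^sup>2"
proof -
  have "complex_of_real ((cmod (u - c * w))\<^sup>2)
      = of_real ((cmod u)\<^sup>2) - (cnj c * (u * cnj w) + cnj (cnj c * (u * cnj w)))
        + of_real ((cmod c)\<^sup>2 * (cmod w)\<^sup>2)"
    unfolding of_real_mult complex_norm_square by (simp add: algebra_simps)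
  then have "Re (complex_of_real ((cmod (u - c * w))\<^sup>2))
      = Re (of_real ((cmod u)\<^sup>2) - (cnj c * (u * cnj w) + cnj (cnj c * (u * cnj w)))
        + of_real ((cmod c)\<^sup>2 * (cmod w)\<^sup>2))"
    by (rule arg_cong)
  then show ?thesis
    by (simp add: algebra_simps)
qed

lemma L2_fun_diff_scaled:
  assumes u: "L2_fun M u" and w: "L2_fun M w"
  shows "L2_fun M (\<lambda>x. u x - c * w x)"
    and "(LINT x|M. (cmod (u x - c * w x))\<^sup>2)
      = (LINT x|M. (cmod (u x))\<^sup>2) - 2 * Re (cnj c * L2_inner M u w)
        + (cmod c)\<^sup>2 * (LINT x|M. (cmod (w x))\<^sup>2)"
proof -
  have [measurable]: "u \<in> borel_measurable M" "w \<in> borel_measurable M"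
    and int: "integrable M (\<lambda>x. (cmod (u x))\<^sup>2)" "integrable M (\<lambda>x. (cmod (w x))\<^sup>2)"
    using assms by (auto simp: L2_fun_def)
  have int': "integrable M (\<lambda>x. cnj c * (u x * cnj (w x)))"
    using L2_fun_integrable_mult[OF u w] by simp
  define r where "r x = Re (cnj c * (u x * cnj (w x)))" for x
  have r: "integrable M r" "integral\<^sup>L M r = Re (cnj c * L2_inner M u w)"
    using integrable_Re[OF int'] integral_Re[OF int'] by (simp_all add: r_def[abs_def] L2_inner_def)
  show "L2_fun M (\<lambda>x. u x - c * w x)"
    unfolding L2_fun_def cmod_diff_scaled_power2 r_def[symmetric] using int r by auto
  show "(LINT x|M. (cmod (u x - c * w x))\<^sup>2)
      = (LINT x|M. (cmod (u x))\<^sup>2) - 2 * Re (cnj c * L2_inner M u w)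
        + (cmod c)\<^sup>2 * (LINT x|M. (cmod (w x))\<^sup>2)"
    unfolding cmod_diff_scaled_power2 r_def[symmetric] using int r by simp
qed

lemma L2_inner_diff_scaled:
  assumes "L2_fun M u" "L2_fun M w" "L2_fun M z"
  shows "L2_inner M (\<lambda>x. u x - c * w x) z = L2_inner M u z - c * L2_inner M w z"
  using L2_fun_integrable_mult[OF assms(1,3)] L2_fun_integrable_mult[OF assms(2,3)]
  by (simp add: L2_inner_def left_diff_distrib mult.assoc)

text \<open>Completing the square in each coefficient: with \<open>a\<close> the coefficient of
  \<open>f\<close> at \<open>e i\<close>, the cross term and the square of \<open>c i\<close>
  combine to \<open>(cmod (c i - a))^2 - (cmod a)^2\<close>. Arbitrary \<open>c\<close> gives the
  lower bound of Parseval, and \<open>c i = a\<close> gives Bessel's inequality.\<close>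

lemma orthonormal_dist_span:
  assumes basis: "L2_orthonormal_basis M I e" and f: "L2_fun M f" and F: "finite F" "F \<subseteq> I"
  shows "(LINT x|M. (cmod (f x - (\<Sum>i\<in>F. c i * e i x)))\<^sup>2)
      = (LINT x|M. (cmod (f x))\<^sup>2) - (\<Sum>i\<in>F. (cmod (L2_inner M f (e i)))\<^sup>2)
        + (\<Sum>i\<in>F. (cmod (c i - L2_inner M f (e i)))\<^sup>2)"
proof -
  let ?u = "\<lambda>F x. f x - (\<Sum>i\<in>F. c i * e i x)"
  have e: "L2_fun M (e i)" if "i \<in> I" for i
    using basis that by (auto simp: L2_orthonormal_basis_def)
  have ee: "L2_inner M (e i) (e j) = (if i = j then 1 else 0)" if "i \<in> I" "j \<in> I" for i j
    using basis that by (auto simp: L2_orthonormal_basis_def)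
  have one: "(LINT x|M. (cmod (e i x))\<^sup>2) = 1" if "i \<in> I" for i
  proof -
    have "complex_of_real (LINT x|M. (cmod (e i x))\<^sup>2) = L2_inner M (e i) (e i)"
      unfolding L2_inner_def complex_norm_square[symmetric] integral_complex_of_real ..
    then show ?thesis using ee[OF that that] by simp
  qed
  \<comment> \<open>The induction also carries the coefficients outside \<open>F\<close>:
    subtracting the terms of \<open>F\<close> leaves them unchanged, so the next index
    \<open>k\<close> still sees the coefficient of \<open>f\<close> itself.\<close>
  have "L2_fun M (?u F) \<and> (\<forall>j\<in>I - F. L2_inner M (?u F) (e j) = L2_inner M f (e j)) \<and>
      (LINT x|M. (cmod (?u F x))\<^sup>2)
      = (LINT x|M. (cmod (f x))\<^sup>2) - (\<Sum>i\<in>F. (cmod (L2_inner M f (e i)))\<^sup>2)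
        + (\<Sum>i\<in>F. (cmod (c i - L2_inner M f (e i)))\<^sup>2)"
    using F
  proof (induction F)
    case empty
    then show ?case using f by simp
  next
    case (insert k F)
    then have k: "k \<in> I" and u: "L2_fun M (?u F)"
      and uk: "L2_inner M (?u F) (e k) = L2_inner M f (e k)"
      by auto
    have step: "?u (insert k F) x = ?u F x - c k * e k x" for x
      using insert.hyps by (simp add: algebra_simps)
    have "L2_inner M (?u (insert k F)) (e j) = L2_inner M f (e j)" if "j \<in> I - insert k F" for j
      unfolding step using that insert by (subst L2_inner_diff_scaled[OF u e e]) (auto simp: ee)
    moreover have "(cmod (c k - L2_inner M f (e k)))\<^sup>2
        = (cmod (L2_inner M f (e k)))\<^sup>2 - 2 * Re (cnj (c k) * L2_inner M f (e k)) + (cmod (c k))\<^sup>2"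
      using cmod_diff_scaled_power2[of "L2_inner M f (e k)" "c k" 1]
      by (simp add: norm_minus_commute)
    ultimately show ?case
      using insert L2_fun_diff_scaled[OF u e[OF k], of "c k"] one[OF k]
      unfolding step uk by simp
  qed
  then show ?thesis by blast
qed

text \<open>By completeness the norm of \<open>f\<close> exceeds some finite coefficient sum by at
  most an arbitrary \<open>\<epsilon>\<close>. That sum is the same for \<open>g\<close>, where
  Bessel's inequality bounds it by the norm of \<open>g\<close>. Exchanging the roles gives
  equality, and no infinite sum over \<open>I\<close> occurs.\<close>

lemma L2_norm_eqI_coefficients:
  assumes basis: "L2_orthonormal_basis M I e" and fg: "L2_fun M f" "L2_fun M g"
    and coeff: "\<And>i. i \<in> I \<Longrightarrow> cmod (L2_inner M f (e i)) = cmod (L2_inner M g (e i))"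
  shows "(LINT x|M. (cmod (f x))\<^sup>2) = (LINT x|M. (cmod (g x))\<^sup>2)"
proof -
  have le: "(LINT x|M. (cmod (f x))\<^sup>2) \<le> (LINT x|M. (cmod (g x))\<^sup>2)"
    if f: "L2_fun M f" and g: "L2_fun M g"
      and coeff: "\<And>i. i \<in> I \<Longrightarrow> cmod (L2_inner M f (e i)) = cmod (L2_inner M g (e i))" for f g
  proof (rule field_le_epsilon)
    fix \<epsilon> :: real assume "\<epsilon> > 0"
    then obtain F c where F: "finite F" "F \<subseteq> I"
      and lt: "(LINT x|M. (cmod (f x - (\<Sum>i\<in>F. c i * e i x)))\<^sup>2) < \<epsilon>"
      using basis f unfolding L2_orthonormal_basis_def by blast
    have "(LINT x|M. (cmod (f x))\<^sup>2) - (\<Sum>i\<in>F. (cmod (L2_inner M f (e i)))\<^sup>2) \<le> \<epsilon>"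
      using lt sum_nonneg[of F "\<lambda>i. (cmod (c i - L2_inner M f (e i)))\<^sup>2"]
      unfolding orthonormal_dist_span[OF basis f F] by simp
    moreover have "(\<Sum>i\<in>F. (cmod (L2_inner M f (e i)))\<^sup>2) = (\<Sum>i\<in>F. (cmod (L2_inner M g (e i)))\<^sup>2)"
      using F coeff by (intro sum.cong) auto
    \<comment> \<open>Bessel's inequality: with the coefficients of \<open>g\<close> itself as
      \<open>c\<close>, the last sum of the distance formula vanishes.\<close>
    moreover have "0 \<le> (LINT x|M. (cmod (g x - (\<Sum>i\<in>F. L2_inner M g (e i) * e i x)))\<^sup>2)"
      by (intro Bochner_Integration.integral_nonneg) auto
    then have "(\<Sum>i\<in>F. (cmod (L2_inner M g (e i)))\<^sup>2) \<le> (LINT x|M. (cmod (g x))\<^sup>2)"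
      unfolding orthonormal_dist_span[OF basis g F] by simp
    ultimately show "(LINT x|M. (cmod (f x))\<^sup>2) \<le> (LINT x|M. (cmod (g x))\<^sup>2) + \<epsilon>"
      by linarith
  qed
  show ?thesis
    using le[OF fg coeff] le[OF fg(2,1) coeff[symmetric]] by (rule antisym)
qed

section \<open>Translation invariance of one-dimensional Hausdorff measure\<close>

text \<open>Translating a cover of \<open>A\<close> gives a cover of the translate by sets of no
  larger diameter. The reverse inequality follows by translating back by \<open>- v\<close>.\<close>

lemma hausdorff1_outer_translate_le:
  fixes A :: "'a::real_normed_vector set"
  shows "hausdorff1_outer ((\<lambda>x. x + v) ` A) \<le> hausdorff1_outer A"
  unfolding hausdorff1_outer_def
proof (rule SUP_mono)
  fix \<delta> :: real assume \<delta>: "\<delta> \<in> {0<..}"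
  have diam: "diameter ((\<lambda>x. x + v) ` U) \<le> diameter U" if "bounded U" for U :: "'a set"
    using that by (intro diameter_le)
      (auto simp: diameter_ge_0 dist_norm[symmetric] intro: diameter_bounded_bound)
  have "hausdorff1_pre \<delta> ((\<lambda>x. x + v) ` A) \<le> hausdorff1_pre \<delta> A"
    unfolding hausdorff1_pre_def[of \<delta> A]
  proof (rule INF_greatest)
    fix U :: "nat \<Rightarrow> 'a set"
    assume U: "U \<in> {U. A \<subseteq> (\<Union>i. U i) \<and> (\<forall>i. bounded (U i) \<and> diameter (U i) \<le> \<delta>)}"
    have "bounded ((\<lambda>x. x + v) ` U i)" for i
      using U bounded_translation[of "U i" v] by (simp add: add.commute)
    moreover have "diameter ((\<lambda>x. x + v) ` U i) \<le> \<delta>" for i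
      using U diam[of "U i"] by (auto intro: order_trans)
    moreover have "(\<lambda>x. x + v) ` A \<subseteq> (\<Union>i. (\<lambda>x. x + v) ` U i)"
      unfolding image_UN[symmetric] using U by (intro image_mono) auto
    ultimately have "hausdorff1_pre \<delta> ((\<lambda>x. x + v) ` A) \<le> (\<Sum>i. ennreal (diameter ((\<lambda>x. x + v) ` U i)))"
      unfolding hausdorff1_pre_def by (intro INF_lower) auto
    also have "\<dots> \<le> (\<Sum>i. ennreal (diameter (U i)))"
      using U diam by (intro suminf_le ennreal_leI) auto
    finally show "hausdorff1_pre \<delta> ((\<lambda>x. x + v) ` A) \<le> (\<Sum>i. ennreal (diameter (U i)))" .
  qed
  with \<delta> show "\<exists>\<delta>'\<in>{0<..}. hausdorff1_pre \<delta> ((\<lambda>x. x + v) ` A) \<le> hausdorff1_pre \<delta>' A"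
    by blast
qed

lemma distr_hausdorff1_translate:
  fixes v :: "'a::euclidean_space"
  shows "distr hausdorff1 hausdorff1 (\<lambda>x. x + v) = hausdorff1"
proof (rule measure_eqI)
  fix A :: "'a set" assume "A \<in> sets (distr hausdorff1 hausdorff1 (\<lambda>x. x + v))"
  then have A: "A \<in> sets borel" by simp
  define B where "B = (\<lambda>x. x + v) -` A"
  have B: "B \<in> sets borel" unfolding B_def
    using measurable_sets[of "\<lambda>x. x + v" borel borel A] A by simp
  have "A = (\<lambda>x. x + v) ` B"
    unfolding B_def by (rule surj_image_vimage_eq[symmetric]) (rule surjI[of _ "\<lambda>x. x - v"], simp)
  moreover from this have "B = (\<lambda>x. x + - v) ` A"
    by (simp add: image_image)
  ultimately have "hausdorff1_outer A = hausdorff1_outer B"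
    by (metis antisym hausdorff1_outer_translate_le)
  then show "emeasure (distr hausdorff1 hausdorff1 (\<lambda>x. x + v)) A = emeasure hausdorff1 A"
    using A B by (simp add: emeasure_distr B_def[symmetric] emeasure_hausdorff1)
qed simp

lemma AE_hausdorff1_translate:
  fixes v :: "'a::euclidean_space"
  assumes "AE x in hausdorff1. P x"
  shows "AE x in hausdorff1. P (x + v)"
proof (rule AE_distrD[of "\<lambda>x. x + v" hausdorff1 hausdorff1 P])
  show "(\<lambda>x. x + v) \<in> measurable hausdorff1 hausdorff1" by simp
  show "AE x in distr hausdorff1 hausdorff1 (\<lambda>x. x + v). P x"
    unfolding distr_hausdorff1_translate by (rule assms)
qed

lemma integral_hausdorff1_translate:
  fixes f :: "'a::euclidean_space \<Rightarrow> 'b::{banach, second_countable_topology}"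
  assumes "f \<in> borel_measurable borel"
  shows "(LINT x|hausdorff1. f (x + v)) = (LINT x|hausdorff1. f x)"
  using integral_distr[of "\<lambda>x. x + v" hausdorff1 hausdorff1 f] assms
  by (simp add: distr_hausdorff1_translate)

lemma integrable_hausdorff1_translate:
  fixes f :: "'a::euclidean_space \<Rightarrow> 'b::{banach, second_countable_topology}"
  assumes "f \<in> borel_measurable borel"
  shows "integrable hausdorff1 (\<lambda>x. f (x + v)) \<longleftrightarrow> integrable hausdorff1 f"
  using integrable_distr_eq[of "\<lambda>x. x + v" hausdorff1 hausdorff1 f] assms
  by (simp add: distr_hausdorff1_translate)

section \<open>Restricted measures and characters\<close>

lemma AE_restr_iff:
  assumes "E \<in> sets M"
  shows "(AE x in restr M E. P x) \<longleftrightarrow> (AE x in M. x \<in> E \<longrightarrow> P x)"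
proof -
  have *: "(0 < (indicator E x :: ennreal)) \<longleftrightarrow> x \<in> E" for x
    by (simp add: indicator_def)
  then show ?thesis
    using assms unfolding restr_def by (subst AE_density) (simp_all only: borel_measurable_indicator *)
qed

lemma exp_char_add: "exp_char l (x + y) = exp_char l x * exp_char l y"
  by (simp add: exp_char_def inner_add_right distrib_left exp_add)

lemma cmod_exp_char [simp]: "cmod (exp_char l x) = 1"
proof -
  have "exp_char l x = cis (2 * pi * (l \<bullet> x))"
    by (simp add: exp_char_def cis_conv_exp mult_ac)
  then show ?thesis by simp
qed

lemma borel_measurable_exp_char [measurable]: "exp_char l \<in> borel_measurable borel"
  unfolding exp_char_def[abs_def] by (intro borel_measurable_continuous_onI continuous_intros)

section \<open>Translation invariance and constancy of the density\<close>

text \<open>The exceptional null set in \<open>trans\<close> depends on \<open>v\<close>. Fubini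
  exchanges the quantifiers and yields one base point \<open>x\<close> that works for almost every
  \<open>v\<close>; then \<open>x + v\<close> runs through almost all of \<open>S\<close>. Fubini is
  applied to the finite restrictions to \<open>S\<close> and to a set \<open>V\<close> of
  translations, as \<open>hausdorff1\<close> itself need not be sigma-finite.\<close>

lemma AE_const_of_translate:
  fixes g :: "'a::euclidean_space \<Rightarrow> real"
  assumes S [measurable]: "S \<in> sets borel" and V [measurable]: "V \<in> sets borel"
    and fin: "emeasure hausdorff1 S < \<infinity>" "emeasure hausdorff1 V < \<infinity>"
    and diff: "\<And>x y. x \<in> S \<Longrightarrow> y \<in> S \<Longrightarrow> y - x \<in> V"
    and g [measurable]: "g \<in> borel_measurable borel"
    and trans: "\<And>v. AE x in hausdorff1. x \<in> S \<longrightarrow> x + v \<in> S \<longrightarrow> g (x + v) = g x"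
    and S_pos: "emeasure hausdorff1 S > 0"
  obtains x where "x \<in> S" "AE y in hausdorff1. y \<in> S \<longrightarrow> g y = g x"
proof -
  let ?M = "restr hausdorff1 S" and ?N = "restr hausdorff1 V"
  interpret M: finite_measure ?M
    using fin by (intro finite_measureI) (simp add: emeasure_restr)
  interpret N: finite_measure ?N
    using fin by (intro finite_measureI) (simp add: emeasure_restr)
  interpret pair_sigma_finite ?N ?M ..
  have "AE x in ?M. x + v \<in> S \<longrightarrow> g (x + v) = g x" for v
    using trans[of v] by (simp add: AE_restr_iff)
  then have "AE v in ?N. AE x in ?M. x + v \<in> S \<longrightarrow> g (x + v) = g x"
    by simp
  moreover have "{p \<in> space (borel \<Otimes>\<^sub>M borel). snd p + fst p \<in> S \<longrightarrow> g (snd p + fst p) = g (snd p)}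
      \<in> sets (borel \<Otimes>\<^sub>M borel)"
    by measurable
  then have "{p \<in> space (?N \<Otimes>\<^sub>M ?M). snd p + fst p \<in> S \<longrightarrow> g (snd p + fst p) = g (snd p)}
      \<in> sets (?N \<Otimes>\<^sub>M ?M)"
    using sets_pair_measure_cong[of ?N borel ?M borel] by (simp add: space_pair_measure)
  ultimately have "AE x in ?M. AE v in ?N. x + v \<in> S \<longrightarrow> g (x + v) = g x"
    using AE_commute[of "\<lambda>v x. x + v \<in> S \<longrightarrow> g (x + v) = g x"] by blast
  moreover have "AE x in ?M. x \<in> S"
    by (simp add: AE_restr_iff)
  ultimately have "AE x in ?M. x \<in> S \<and> (AE v in ?N. x + v \<in> S \<longrightarrow> g (x + v) = g x)"
    by eventually_elim auto
  \<comment> \<open>Since \<open>S\<close> has positive measure, a property that holds almost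
    everywhere on \<open>S\<close> holds at some point.\<close>
  moreover have "ae_filter ?M \<noteq> bot"
    using S_pos by (auto simp: ae_filter_eq_bot_iff emeasure_restr)
  ultimately obtain x where x: "x \<in> S" and ae: "AE v in ?N. x + v \<in> S \<longrightarrow> g (x + v) = g x"
    using eventually_happens'[of "ae_filter ?M"] by blast
  from ae have "AE v in hausdorff1. v \<in> V \<longrightarrow> x + v \<in> S \<longrightarrow> g (x + v) = g x"
    by (simp add: AE_restr_iff)
  \<comment> \<open>Substituting \<open>v = y - x\<close>, which lies in \<open>V\<close> for all
    \<open>y\<close> in \<open>S\<close>.\<close>
  from AE_hausdorff1_translate[OF this, of "- x"]
  have "AE y in hausdorff1. y \<in> S \<longrightarrow> g y = g x"
    by eventually_elim (use diff[OF x] in auto)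
  with x show thesis by (rule that)
qed

text \<open>Parseval is tested on the set where the inequality fails. There the ratio of the
  densities is below 1, so both test functions are bounded and hence square-integrable for the
  finite measure \<open>\<mu>\<close>. This is why one inequality is treated at a time.\<close>

lemma spectral_density_translate_le:
  fixes g :: "'a::euclidean_space \<Rightarrow> real"
  assumes basis: "L2_orthonormal_basis \<mu> \<Lambda> exp_char"
    and fin: "finite_measure \<mu>" and \<mu>: "\<mu> = density hausdorff1 g"
    and g [measurable]: "g \<in> borel_measurable borel" and nonneg: "AE x in hausdorff1. 0 \<le> g x"
    and S [measurable]: "S \<in> sets borel"
    and pos: "AE x in hausdorff1. x \<in> S \<longrightarrow> 0 < g x"
  shows "AE x in hausdorff1. x \<in> S \<longrightarrow> x + v \<in> S \<longrightarrow> g (x + v) \<le> g x"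
proof -
  interpret finite_measure \<mu> by fact
  have sets_\<mu> [measurable_cong]: "sets \<mu> = sets borel"
    by (simp add: \<mu>)
  have transfer: "integral\<^sup>L \<mu> F = (LINT x|hausdorff1. g x *\<^sub>R F x)"
      "integrable \<mu> F \<longleftrightarrow> integrable hausdorff1 (\<lambda>x. g x *\<^sub>R F x)"
    if "F \<in> borel_measurable borel" for F :: "'a \<Rightarrow> 'b::{banach, second_countable_topology}"
    unfolding \<mu> using that nonneg by (simp_all add: integral_density integrable_density)
  \<comment> \<open>Positivity of \<open>g\<close> is known only almost everywhere on
    \<open>S\<close>. Including \<open>0 < g x\<close> in \<open>A\<close> makes all later bounds on
    \<open>A\<close> pointwise; \<open>pos\<close> removes this condition at the end.\<close>
  define A where "A = {x \<in> S. x + v \<in> S \<and> 0 < g x \<and> g x < g (x + v)}"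
  have A [measurable]: "A \<in> sets borel"
    unfolding A_def by measurable
  have AD: "x \<in> S" "x + v \<in> S" "0 < g x" "g x < g (x + v)" if "x \<in> A" for x
    using that by (auto simp: A_def)
  define k where "k x = indicator A x * g x / g (x + v)" for x
  have k [measurable]: "k \<in> borel_measurable borel"
    unfolding k_def[abs_def] by measurable
  have k01: "0 \<le> k x" "k x \<le> 1" for x
    using AD[of x] by (auto simp: k_def indicator_def)
  have kg: "g (x + v) * k x = indicator A x * g x" for x
    using AD[of x] by (auto simp: k_def indicator_def)
  \<comment> \<open>The weight in \<open>f'\<close> is chosen so that \<open>f' \<mu>\<close> is the
    translate of \<open>f \<mu>\<close> by \<open>v\<close>. Their coefficients therefore differ
    only by the unimodular factor \<open>cnj (exp_char l v)\<close>.\<close>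
  define f f' :: "'a \<Rightarrow> complex"
    where "f x = of_real (indicator A x)" and "f' x = of_real (k (x - v))" for x
  have f [measurable]: "f \<in> borel_measurable borel" "f' \<in> borel_measurable borel"
    unfolding f_def[abs_def] f'_def[abs_def] by measurable
  have L2: "L2_fun \<mu> h" if [measurable]: "h \<in> borel_measurable borel" and "\<And>x. cmod (h x) \<le> 1" for h
    unfolding L2_fun_def using that(2)
    by (auto intro!: integrable_const_bound[where B = 1] simp: power_le_one)
  have L2f: "L2_fun \<mu> f" "L2_fun \<mu> f'"
    using k01 by (auto intro!: L2 simp: f_def f'_def indicator_def)
  have "cmod (L2_inner \<mu> f (exp_char l)) = cmod (L2_inner \<mu> f' (exp_char l))" for l
  proof -
    let ?\<psi> = "\<lambda>x. (indicator A x * g x) *\<^sub>R cnj (exp_char l x)"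
    have "L2_inner \<mu> f (exp_char l)
        = (LINT x|hausdorff1. g x *\<^sub>R (f x * cnj (exp_char l x)))"
      unfolding L2_inner_def by (rule transfer) auto
    also have "\<dots> = (LINT x|hausdorff1. ?\<psi> x)"
      using AD by (intro Bochner_Integration.integral_cong) (auto simp: f_def indicator_def)
    finally have 1: "L2_inner \<mu> f (exp_char l) = (LINT x|hausdorff1. ?\<psi> x)" .
    have "L2_inner \<mu> f' (exp_char l)
        = (LINT x|hausdorff1. g x *\<^sub>R (f' x * cnj (exp_char l x)))"
      unfolding L2_inner_def by (rule transfer) auto
    also have "\<dots> = (LINT x|hausdorff1. g (x + v) *\<^sub>R (f' (x + v) * cnj (exp_char l (x + v))))"
      by (rule integral_hausdorff1_translate
          [of "\<lambda>x. g x *\<^sub>R (f' x * cnj (exp_char l x))", symmetric]) auto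
    also have "\<dots> = (LINT x|hausdorff1. cnj (exp_char l v) * ?\<psi> x)"
    proof (intro Bochner_Integration.integral_cong refl)
      fix x
      have "g (x + v) *\<^sub>R (f' (x + v) * cnj (exp_char l (x + v)))
          = (g (x + v) * k x) *\<^sub>R (cnj (exp_char l v) * cnj (exp_char l x))"
        by (simp add: f'_def exp_char_add scaleR_conv_of_real mult_ac)
      then show "g (x + v) *\<^sub>R (f' (x + v) * cnj (exp_char l (x + v)))
          = cnj (exp_char l v) * ?\<psi> x"
        unfolding kg by (simp add: scaleR_conv_of_real mult_ac)
    qed
    finally have "L2_inner \<mu> f' (exp_char l) = cnj (exp_char l v) * (LINT x|hausdorff1. ?\<psi> x)"
      unfolding integral_mult_right_zero .
    then show ?thesis
      unfolding 1 by (simp only: norm_mult complex_mod_cnj cmod_exp_char mult_1)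
  qed
  from L2_norm_eqI_coefficients[OF basis L2f this]
  have "(LINT x|\<mu>. (cmod (f x))\<^sup>2) = (LINT x|\<mu>. (cmod (f' x))\<^sup>2)" .
  moreover have "(LINT x|\<mu>. (cmod (f x))\<^sup>2) = (LINT x|hausdorff1. indicator A x * g x)"
      "integrable hausdorff1 (\<lambda>x. indicator A x * g x)"
  proof -
    have F: "g x *\<^sub>R (cmod (f x))\<^sup>2 = indicator A x * g x" for x
      using AD[of x] by (auto simp: f_def indicator_def)
    then show "(LINT x|\<mu>. (cmod (f x))\<^sup>2) = (LINT x|hausdorff1. indicator A x * g x)"
      "integrable hausdorff1 (\<lambda>x. indicator A x * g x)"
      using L2f(1) transfer[of "\<lambda>x. (cmod (f x))\<^sup>2"] unfolding F
      by (simp_all add: L2_fun_def)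
  qed
  moreover have "(LINT x|\<mu>. (cmod (f' x))\<^sup>2) = (LINT x|hausdorff1. indicator A x * g x * k x)"
      "integrable hausdorff1 (\<lambda>x. indicator A x * g x * k x)"
  proof -
    let ?F = "\<lambda>x. g x *\<^sub>R (cmod (f' x))\<^sup>2"
    \<comment> \<open>After the shift the squared norm of \<open>f'\<close> has integrand
      \<open>g (x + v) * (k x)^2\<close>. By \<open>kg\<close> one factor \<open>k x\<close> turns
      \<open>g (x + v)\<close> into \<open>g x\<close> on \<open>A\<close>, and the other
      remains.\<close>
    have F: "?F (x + v) = indicator A x * g x * k x" for x
      unfolding kg[symmetric] by (simp add: f'_def power2_eq_square)
    have meas: "?F \<in> borel_measurable borel"
      by measurable
    have F_int: "(LINT x|\<mu>. (cmod (f' x))\<^sup>2) = (LINT x|hausdorff1. ?F x)" "integrable hausdorff1 ?F"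
      using L2f(2) transfer[of "\<lambda>x. (cmod (f' x))\<^sup>2"] by (simp_all add: L2_fun_def)
    show "(LINT x|\<mu>. (cmod (f' x))\<^sup>2) = (LINT x|hausdorff1. indicator A x * g x * k x)"
      using integral_hausdorff1_translate[OF meas, of v] unfolding F F_int(1) by (rule sym)
    show "integrable hausdorff1 (\<lambda>x. indicator A x * g x * k x)"
      using F_int(2) integrable_hausdorff1_translate[OF meas, of v] unfolding F by blast
  qed
  ultimately have D: "(LINT x|hausdorff1. indicator A x * g x - indicator A x * g x * k x) = 0"
      "integrable hausdorff1 (\<lambda>x. indicator A x * g x - indicator A x * g x * k x)"
    by simp_all
  \<comment> \<open>The integrand is \<open>g * (1 - k)\<close> on \<open>A\<close> and zero
    elsewhere. It is nonnegative with integral zero, but strictly positive on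
    \<open>A\<close>.\<close>
  have "0 \<le> indicator A x * g x" for x
    using AD(3)[of x] by (cases "x \<in> A") simp_all
  then have nn: "0 \<le> indicator A x * g x - indicator A x * g x * k x" for x
    using mult_left_le[OF k01(2)[of x]] by (simp only: diff_ge_0_iff_ge)
  have ae: "AE x in hausdorff1. indicator A x * g x - indicator A x * g x * k x = 0"
    using integral_nonneg_eq_0_iff_AE[OF D(2) AE_I2[OF nn]] D(1) by (rule iffD1)
  have notA: "x \<notin> A" if "indicator A x * g x - indicator A x * g x * k x = 0" for x
  proof
    assume x: "x \<in> A"
    then have "k x < 1" using AD[of x] by (simp add: k_def)
    then have "indicator A x * g x * k x < indicator A x * g x"
      using AD(3)[OF x] x by simp
    with that show False by linarith
  qed
  have "AE x in hausdorff1. x \<notin> A"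
    using ae by (rule eventually_mono) (rule notA)
  then show ?thesis
    using pos by eventually_elim (auto simp: A_def)
qed

text \<open>The reverse inequality is the previous one for the translation \<open>- v\<close>,
  evaluated at \<open>x + v\<close>.\<close>

lemma spectral_density_translate:
  fixes g :: "'a::euclidean_space \<Rightarrow> real"
  assumes "L2_orthonormal_basis \<mu> \<Lambda> exp_char"
    and "finite_measure \<mu>" and "\<mu> = density hausdorff1 g"
    and "g \<in> borel_measurable borel" and "AE x in hausdorff1. 0 \<le> g x"
    and "S \<in> sets borel"
    and "AE x in hausdorff1. x \<in> S \<longrightarrow> 0 < g x"
  shows "AE x in hausdorff1. x \<in> S \<longrightarrow> x + v \<in> S \<longrightarrow> g (x + v) = g x"
proof -
  have "AE x in hausdorff1. x + v \<in> S \<longrightarrow> x + v + - v \<in> S \<longrightarrow> g (x + v + - v) \<le> g (x + v)"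
    by (rule AE_hausdorff1_translate[OF spectral_density_translate_le[OF assms]])
  with spectral_density_translate_le[OF assms, of v] show ?thesis
    by eventually_elim auto
qed

text \<open>All differences of points of a segment lie in a segment centred at the origin. Its
  length is finite, so it can serve as the set \<open>V\<close> of translations.\<close>

lemma diff_closed_segment_mem:
  assumes "x \<in> closed_segment c d" "y \<in> closed_segment c d"
  shows "y - x \<in> closed_segment (c - d) (d - c)"
proof -
  obtain s t where s: "0 \<le> s" "s \<le> 1" "x = (1 - s) *\<^sub>R c + s *\<^sub>R d"
    and t: "0 \<le> t" "t \<le> 1" "y = (1 - t) *\<^sub>R c + t *\<^sub>R d"
    using assms by (auto simp: in_segment)
  \<comment> \<open>The solution of \<open>r - (1 - r) = t - s\<close>.\<close>
  define r where "r = (1 + t - s) / 2"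
  have "y - x = (t - s) *\<^sub>R (d - c)"
    unfolding s(3) t(3) by (simp add: algebra_simps)
  also have "t - s = r - (1 - r)"
    by (simp add: r_def field_simps)
  also have "(r - w) *\<^sub>R (d - c) = w *\<^sub>R (c - d) + r *\<^sub>R (d - c)" for w
    by (simp add: algebra_simps)
  finally show ?thesis
    using s(1,2) t(1,2) unfolding in_segment by (intro exI[of _ r]) (auto simp: r_def)
qed

lemma spectral_density_const_on_collinear:
  fixes g :: "'a::euclidean_space \<Rightarrow> real"
  assumes spec: "L2_orthonormal_basis \<mu> \<Lambda> exp_char" "finite_measure \<mu>" "\<mu> = density hausdorff1 g"
      "g \<in> borel_measurable borel" "AE x in hausdorff1. 0 \<le> g x"
      "S \<in> sets borel" "AE x in hausdorff1. x \<in> S \<longrightarrow> 0 < g x"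
    and seg: "S \<subseteq> closed_segment c d" and S_pos: "emeasure hausdorff1 S > 0"
  obtains r where "r > 0" "AE x in hausdorff1. x \<in> S \<longrightarrow> g x = r"
proof -
  have "emeasure hausdorff1 S \<le> emeasure hausdorff1 (closed_segment c d)"
    using seg by (intro emeasure_mono) (auto simp: borel_closed)
  also have "\<dots> < \<infinity>"
    by (simp add: emeasure_hausdorff1_closed_segment)
  finally have "emeasure hausdorff1 S < \<infinity>" .
  moreover have "emeasure hausdorff1 (closed_segment (c - d) (d - c)) < \<infinity>"
    by (simp add: emeasure_hausdorff1_closed_segment)
  moreover have "closed_segment (c - d) (d - c) \<in> sets borel"
    by (simp add: borel_closed)
  moreover have "y - x \<in> closed_segment (c - d) (d - c)" if "x \<in> S" "y \<in> S" for x y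
    using that seg by (intro diff_closed_segment_mem) auto
  ultimately obtain x where ae: "AE y in hausdorff1. y \<in> S \<longrightarrow> g y = g x"
    using AE_const_of_translate[of S "closed_segment (c - d) (d - c)" g] S_pos spec(4,6)
      spectral_density_translate[OF spec] by metis
  \<comment> \<open>The constant is positive, for otherwise \<open>g > 0\<close> almost everywhere
    on \<open>S\<close> would make \<open>S\<close> a null set.\<close>
  have "g x > 0"
  proof (rule ccontr)
    assume le: "\<not> g x > 0"
    have "AE y in hausdorff1. y \<notin> S"
      using ae spec(7) by eventually_elim (use le in auto)
    then show False
      using AE_iff_null_sets[of S hausdorff1] spec(6) S_pos by auto
  qed
  then show thesis using ae by (rule that)
qed

section \<open>Calculus of densities, restrictions and sums of measures\<close>

text \<open>
  Unlike in \<open>density_cong\<close>, the functions need not be measurable: an integrable function on a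
  segment may be non-measurable off the segment.
\<close>

lemma density_cong_AE:
  assumes "AE x in M. f x = g x"
  shows "density M f = density M g"
proof -
  have "(\<integral>\<^sup>+ x. f x * indicator A x \<partial>M) = (\<integral>\<^sup>+ x. g x * indicator A x \<partial>M)" for A
    using assms by (intro nn_integral_cong_AE) auto
  then show ?thesis
    by (simp add: density_def)
qed

lemma density_const_eq_scale_measure: "density M (\<lambda>_. c) = scale_measure c M"
  by (rule measure_eqI) (simp_all add: emeasure_density nn_integral_cmult)

text \<open>The restricted measure does not see \<open>f\<close> off \<open>E\<close>, so
  \<open>f\<close> may be replaced by its product with the indicator. Measurability is asked of this
  product, which is what \<open>set_integrable\<close> provides.\<close>

lemma density_restr:
  assumes E: "E \<in> sets M" and f: "(\<lambda>x. indicator E x * f x) \<in> borel_measurable M"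
  shows "density (restr M E) (\<lambda>x. ennreal (f x)) = density M (\<lambda>x. ennreal (indicator E x * f x))"
proof -
  have "density (restr M E) (\<lambda>x. ennreal (f x)) = density (restr M E) (\<lambda>x. ennreal (indicator E x * f x))"
    using E by (intro density_cong_AE) (simp add: AE_restr_iff)
  also have "\<dots> = density M (\<lambda>x. indicator E x * ennreal (indicator E x * f x))"
    unfolding restr_def using E f by (intro density_density_eq) auto
  also have "(\<lambda>x. indicator E x * ennreal (indicator E x * f x)) = (\<lambda>x. ennreal (indicator E x * f x))"
    by (auto simp: indicator_def)
  finally show ?thesis .
qed

lemma add_measure_density:
  assumes [measurable]: "f \<in> borel_measurable M" "g \<in> borel_measurable M"
  shows "add_measure (density M f) (density M g) = density M (\<lambda>x. f x + g x)"
proof (rule measure_eqI)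
  fix A assume "A \<in> sets (add_measure (density M f) (density M g))"
  then have [measurable]: "A \<in> sets M" by simp
  have "emeasure (add_measure (density M f) (density M g)) A
      = (\<integral>\<^sup>+ x. f x * indicator A x \<partial>M) + (\<integral>\<^sup>+ x. g x * indicator A x \<partial>M)"
    by (simp add: emeasure_add_measure emeasure_density)
  also have "\<dots> = emeasure (density M (\<lambda>x. f x + g x)) A"
    by (simp add: emeasure_density nn_integral_add[symmetric] distrib_right)
  finally show "emeasure (add_measure (density M f) (density M g)) A
      = emeasure (density M (\<lambda>x. f x + g x)) A" .
qed simp

section \<open>Collinearity of overlapping segments\<close>

text \<open>If the two points have parameters \<open>s\<close> and \<open>t\<close>, then
  \<open>y - x\<close> is \<open>t - s\<close> times \<open>b - a\<close>. As \<open>t\<close>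
  differs from \<open>s\<close>, this can be solved for the endpoints.\<close>

lemma line_through_segment_points:
  fixes a b x y :: "'a::real_vector"
  assumes "x \<in> closed_segment a b" "y \<in> closed_segment a b" "x \<noteq> y"
  obtains \<alpha> \<beta> where "a = x + \<alpha> *\<^sub>R (y - x)" "b = x + \<beta> *\<^sub>R (y - x)"
proof -
  obtain s t where x: "x = (1 - s) *\<^sub>R a + s *\<^sub>R b" and y: "y = (1 - t) *\<^sub>R a + t *\<^sub>R b"
    using assms(1,2) by (auto simp: in_segment)
  have ne: "t - s \<noteq> 0" using assms(3) x y by auto
  have yx: "y - x = (t - s) *\<^sub>R (b - a)"
    unfolding x y by (simp add: algebra_simps)
  have *: "(- s / (t - s)) *\<^sub>R (y - x) = - s *\<^sub>R (b - a)"
      "((1 - s) / (t - s)) *\<^sub>R (y - x) = (1 - s) *\<^sub>R (b - a)"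
    unfolding yx using ne by simp_all
  have "a = x + (- s / (t - s)) *\<^sub>R (y - x)" "b = x + ((1 - s) / (t - s)) *\<^sub>R (y - x)"
    unfolding * by (simp_all add: x algebra_simps)
  then show thesis by (rule that)
qed

lemma overlapping_segments_collinear:
  fixes a b a' b' x y :: "'a::real_vector"
  assumes x: "x \<in> closed_segment a b \<inter> closed_segment a' b'"
    and y: "y \<in> closed_segment a b \<inter> closed_segment a' b'" and ne: "x \<noteq> y"
  obtains c d where "closed_segment a b \<union> closed_segment a' b' \<subseteq> closed_segment c d"
proof -
  obtain \<alpha> \<beta> where 1: "a = x + \<alpha> *\<^sub>R (y - x)" "b = x + \<beta> *\<^sub>R (y - x)"
    using x y ne by (auto elim: line_through_segment_points)
  obtain \<alpha>' \<beta>' where 2: "a' = x + \<alpha>' *\<^sub>R (y - x)" "b' = x + \<beta>' *\<^sub>R (y - x)"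
    using x y ne by (auto elim: line_through_segment_points)
  \<comment> \<open>A bound for the line parameters of all four endpoints; the summand 1 keeps it
    positive, so that \<open>2 * R\<close> can be divided by below.\<close>
  define R where "R = 1 + \<bar>\<alpha>\<bar> + \<bar>\<beta>\<bar> + \<bar>\<alpha>'\<bar> + \<bar>\<beta>'\<bar>"
  have R: "R > 0" "\<bar>\<alpha>\<bar> \<le> R" "\<bar>\<beta>\<bar> \<le> R" "\<bar>\<alpha>'\<bar> \<le> R" "\<bar>\<beta>'\<bar> \<le> R"
    by (auto simp: R_def)
  let ?c = "x - R *\<^sub>R (y - x)" and ?d = "x + R *\<^sub>R (y - x)"
  have mem: "x + r *\<^sub>R (y - x) \<in> closed_segment ?c ?d" if "\<bar>r\<bar> \<le> R" for r
  proof -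
    define u where "u = (r + R) / (2 * R)"
    have u: "0 \<le> u" "u \<le> 1" using that R(1) by (auto simp: u_def field_simps)
    have "r = u * R - (1 - u) * R" using R(1) by (simp add: u_def field_simps)
    moreover have "w *\<^sub>R ?c + u *\<^sub>R ?d = (w + u) *\<^sub>R x + (u * R - w * R) *\<^sub>R (y - x)" for w
      by (simp add: algebra_simps)
    ultimately have "x + r *\<^sub>R (y - x) = (1 - u) *\<^sub>R ?c + u *\<^sub>R ?d" by simp
    with u show ?thesis by (auto simp: in_segment)
  qed
  have "closed_segment a b \<subseteq> closed_segment ?c ?d" "closed_segment a' b' \<subseteq> closed_segment ?c ?d"
    using mem R unfolding 1 2 by (simp_all add: closed_segment_subset)
  then show thesis by (intro that) auto
qed

text \<open>A single point is a degenerate segment and thus has measure zero.\<close>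

lemma hausdorff1_pos_imp_two_points:
  fixes E :: "'a::euclidean_space set"
  assumes "emeasure hausdorff1 E > 0"
  obtains x y where "x \<in> E" "y \<in> E" "x \<noteq> y"
proof (rule ccontr)
  assume no: "\<not> thesis"
  have "E \<noteq> {}" using assms by auto
  then obtain x where "x \<in> E" by blast
  with no that have "E = {x}" by blast
  then show False
    using assms emeasure_hausdorff1_closed_segment[of x x] by simp
qed

section \<open>Spectral measures on two segments, with null or with positive overlap\<close>

theorem theorem1:
  fixes a1 b1 a2 b2 :: "real ^ 'n"
    and I1 I2 :: "(real ^ 'n) set"
    and f1 f2 :: "real ^ 'n \<Rightarrow> real"
    and \<mu> :: "(real ^ 'n) measure"
  assumes dim: "CARD('n) \<ge> 2"
    and I1: "I1 = closed_segment a1 b1" "a1 \<noteq> b1"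
    and I2: "I2 = closed_segment a2 b2" "a2 \<noteq> b2"
    and f1: "set_integrable hausdorff1 I1 f1" "AE x in hausdorff1. x \<in> I1 \<longrightarrow> f1 x > 0"
    and f2: "set_integrable hausdorff1 I2 f2" "AE x in hausdorff1. x \<in> I2 \<longrightarrow> f2 x > 0"
    and \<mu>: "\<mu> = add_measure (density (restr hausdorff1 I1) f1) (density (restr hausdorff1 I2) f2)"
    and prob: "prob_space \<mu>"
    and spectral: "spectral_measure \<mu>"
  shows
    "(emeasure hausdorff1 (I1 \<inter> I2) = 0 \<longrightarrow>
        (\<exists>c1 c2 :: real. c1 > 0 \<and> c2 > 0 \<and>
           (AE x in hausdorff1. x \<in> I1 \<longrightarrow> f1 x = c1) \<and>
           (AE x in hausdorff1. x \<in> I2 \<longrightarrow> f2 x = c2) \<and>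
           \<mu> = add_measure (scale_measure c1 (restr hausdorff1 I1))
                           (scale_measure c2 (restr hausdorff1 I2)))) \<and>
     (emeasure hausdorff1 (I1 \<inter> I2) > 0 \<longrightarrow>
        (AE x in hausdorff1. x \<in> I1 \<union> I2 \<longrightarrow>
           f1 x * indicator I1 x + f2 x * indicator I2 x = 1 / measure hausdorff1 (I1 \<union> I2)) \<and>
        \<mu> = scale_measure (1 / measure hausdorff1 (I1 \<union> I2)) (restr hausdorff1 (I1 \<union> I2)))"
proof -
  \<comment> \<open>Extending both densities by zero turns \<open>\<mu>\<close> into one density
    \<open>G\<close> with respect to \<open>hausdorff1\<close>, to which the constancy result
    applies.\<close>
  define g1 where "g1 x = indicator I1 x * f1 x" for x
  define g2 where "g2 x = indicator I2 x * f2 x" for x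
  define G where "G x = g1 x + g2 x" for x
  have I [measurable]: "I1 \<in> sets borel" "I2 \<in> sets borel"
    unfolding I1(1) I2(1) by (simp_all add: borel_closed)
  have g [measurable]: "g1 \<in> borel_measurable borel" "g2 \<in> borel_measurable borel"
    using f1(1) f2(1) borel_measurable_integrable[of hausdorff1]
    by (auto simp: set_integrable_def g1_def[abs_def] g2_def[abs_def] cong: measurable_cong_sets)
  have G [measurable]: "G \<in> borel_measurable borel"
    unfolding G_def[abs_def] by measurable
  have nonneg: "AE x in hausdorff1. 0 \<le> g1 x \<and> 0 \<le> g2 x"
    using f1(2) f2(2) by eventually_elim (auto simp: g1_def g2_def indicator_def)
  have pos: "AE x in hausdorff1. x \<in> I1 \<union> I2 \<longrightarrow> 0 < G x"
    using f1(2) f2(2)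
    by eventually_elim (auto simp: G_def g1_def g2_def indicator_def)
  have "\<mu> = add_measure (density hausdorff1 g1) (density hausdorff1 g2)"
    unfolding \<mu> g1_def g2_def using I g
    by (subst (1 2) density_restr) (simp_all add: g1_def[abs_def] g2_def[abs_def])
  also have "\<dots> = density hausdorff1 (\<lambda>x. ennreal (g1 x) + ennreal (g2 x))"
    by (rule add_measure_density) auto
  also have "\<dots> = density hausdorff1 G"
  proof (rule density_cong_AE)
    show "AE x in hausdorff1. ennreal (g1 x) + ennreal (g2 x) = ennreal (G x)"
      using nonneg by eventually_elim (simp add: G_def)
  qed
  finally have \<mu>G: "\<mu> = density hausdorff1 G" .
  obtain L where L: "L2_orthonormal_basis \<mu> L exp_char"
    using spectral by (auto simp: spectral_measure_def spectrum_of_def)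
  have fin: "finite_measure \<mu>"
    using prob by (rule prob_space.finite_measure)
  have const: "\<exists>r>0. AE x in hausdorff1. x \<in> S \<longrightarrow> G x = r"
    if S: "S \<in> sets borel" "S \<subseteq> I1 \<union> I2" "S \<subseteq> closed_segment c d" "0 < emeasure hausdorff1 S" for S c d
  proof -
    have "AE x in hausdorff1. 0 \<le> G x"
      using nonneg by eventually_elim (auto simp: G_def)
    moreover have "AE x in hausdorff1. x \<in> S \<longrightarrow> 0 < G x"
      using pos by eventually_elim (use S(2) in auto)
    ultimately show ?thesis
      using spectral_density_const_on_collinear[OF L fin \<mu>G G _ S(1) _ S(3,4)] by blast
  qed
  have I_pos: "0 < emeasure hausdorff1 I1" "0 < emeasure hausdorff1 I2"
    using I1 I2 by (simp_all add: emeasure_hausdorff1_closed_segment)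
  show ?thesis
  proof (intro conjI impI)
    assume null: "emeasure hausdorff1 (I1 \<inter> I2) = 0"
    \<comment> \<open>Off this null set only one of the two densities contributes to
      \<open>G\<close>, so the constant value of \<open>G\<close> on each segment is that of
      \<open>f1\<close> or \<open>f2\<close>.\<close>
    have "AE x in hausdorff1. x \<notin> I1 \<inter> I2"
      using null I by (intro AE_not_in null_setsI) auto
    obtain c1 where c1: "c1 > 0" "AE x in hausdorff1. x \<in> I1 \<longrightarrow> G x = c1"
      using const[of I1 a1 b1] I I_pos I1(1) by auto
    obtain c2 where c2: "c2 > 0" "AE x in hausdorff1. x \<in> I2 \<longrightarrow> G x = c2"
      using const[of I2 a2 b2] I I_pos I2(1) by auto
    have f1c: "AE x in hausdorff1. x \<in> I1 \<longrightarrow> f1 x = c1"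
      using c1(2) \<open>AE x in hausdorff1. x \<notin> I1 \<inter> I2\<close>
      by eventually_elim (auto simp: G_def g1_def g2_def)
    have f2c: "AE x in hausdorff1. x \<in> I2 \<longrightarrow> f2 x = c2"
      using c2(2) \<open>AE x in hausdorff1. x \<notin> I1 \<inter> I2\<close>
      by eventually_elim (auto simp: G_def g1_def g2_def)
    have scale: "density (restr hausdorff1 E) (\<lambda>x. ennreal (f x)) = scale_measure (ennreal c) (restr hausdorff1 E)"
      if "E \<in> sets borel" "AE x in hausdorff1. x \<in> E \<longrightarrow> f x = c" for E f c
    proof -
      have "density (restr hausdorff1 E) (\<lambda>x. ennreal (f x)) = density (restr hausdorff1 E) (\<lambda>_. ennreal c)"
        using that by (intro density_cong_AE) (auto simp: AE_restr_iff elim!: eventually_mono)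
      then show ?thesis by (simp only: density_const_eq_scale_measure)
    qed
    have "\<mu> = add_measure (scale_measure c1 (restr hausdorff1 I1)) (scale_measure c2 (restr hausdorff1 I2))"
      unfolding \<mu> scale[OF I(1) f1c] scale[OF I(2) f2c] ..
    then show "\<exists>c1 c2 :: real. c1 > 0 \<and> c2 > 0 \<and>
        (AE x in hausdorff1. x \<in> I1 \<longrightarrow> f1 x = c1) \<and>
        (AE x in hausdorff1. x \<in> I2 \<longrightarrow> f2 x = c2) \<and>
        \<mu> = add_measure (scale_measure c1 (restr hausdorff1 I1))
                        (scale_measure c2 (restr hausdorff1 I2))"
      using c1(1) c2(1) f1c f2c by blast
  next
    assume overlap: "0 < emeasure hausdorff1 (I1 \<inter> I2)"
    let ?S = "I1 \<union> I2"
    \<comment> \<open>Two distinct common points put both segments on one line, so the union lies in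
      a single segment and \<open>const\<close> applies to it as a whole.\<close>
    obtain x y where "x \<in> I1 \<inter> I2" "y \<in> I1 \<inter> I2" "x \<noteq> y"
      using overlap by (rule hausdorff1_pos_imp_two_points)
    then obtain c d where cd: "?S \<subseteq> closed_segment c d"
      unfolding I1(1) I2(1) by (rule overlapping_segments_collinear)
    have "emeasure hausdorff1 I1 \<le> emeasure hausdorff1 ?S"
      by (intro emeasure_mono) auto
    then have "0 < emeasure hausdorff1 ?S"
      using I_pos(1) by (rule less_le_trans[rotated])
    then obtain r where r: "r > 0" "AE x in hausdorff1. x \<in> ?S \<longrightarrow> G x = r"
      using const[OF _ _ cd] by auto
    have "AE x in hausdorff1. ennreal (G x) = indicator ?S x * ennreal r"
      using r(2) by eventually_elim (auto simp: G_def g1_def g2_def indicator_def)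
    then have "\<mu> = density hausdorff1 (\<lambda>x. indicator ?S x * ennreal r)"
      unfolding \<mu>G by (rule density_cong_AE)
    also have "\<dots> = density (restr hausdorff1 ?S) (\<lambda>_. ennreal r)"
      unfolding restr_def by (rule density_density_eq[symmetric]) auto
    finally have \<mu>r: "\<mu> = scale_measure r (restr hausdorff1 ?S)"
      by (simp only: density_const_eq_scale_measure)
    \<comment> \<open>The total mass 1 determines \<open>r\<close>. A product equal to 1 also shows
      that the measure divided by is nonzero.\<close>
    have "1 = emeasure \<mu> UNIV"
      using prob_space.emeasure_space_1[OF prob] by (simp add: \<mu>G)
    also have "\<dots> = ennreal r * emeasure hausdorff1 ?S"
      unfolding \<mu>r by (simp add: emeasure_restr)
    finally have "enn2real (ennreal r * emeasure hausdorff1 ?S) = 1" by simp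
    then have "r * measure hausdorff1 ?S = 1"
      using r(1) by (simp add: enn2real_mult measure_def)
    then have r_eq: "r = 1 / measure hausdorff1 ?S"
      by (metis eq_divide_imp mult_zero_right zero_neq_one)
    show "\<mu> = scale_measure (1 / measure hausdorff1 ?S) (restr hausdorff1 ?S)"
      using \<mu>r unfolding r_eq .
    have "G x = f1 x * indicator I1 x + f2 x * indicator I2 x" for x
      by (simp add: G_def g1_def g2_def mult.commute)
    then show "AE x in hausdorff1. x \<in> ?S \<longrightarrow>
        f1 x * indicator I1 x + f2 x * indicator I2 x = 1 / measure hausdorff1 ?S"
      using r(2) unfolding r_eq by simp
  qed
qed

end
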